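(* For each even integer $k\ge 4$ and each integer $n$ with $2k\le n\le 3k-2$, we have $d(n,2(k-1),\chi=k)=k-1$.
   Context: All graphs are finite and simple. For a graph $G$, $\chi(G)$ denotes its chromatic number. A set $S$ of vertices of $G$ together with an assignment of colors to the vertices of $S$ is a defining set of the vertex coloring of $G$ if this partial coloring extends in exactly one way to a proper coloring of all vertices of $G$ with $\chi(G)$ colors. The defining number $d(G,\chi)$ is the minimum cardinality of a defining set of $G$. For integers $n,r,k$, $d(n,r,\chi=k)$ denotes the minimum of $d(G,\chi)$ over all $r$-regular graphs $G$ on $n$ vertices with $\chi(G)=k$. *)

theory Defs
  imports "Graph_Theory.Pair_Digraph" "HOL-Library.FuncSet" "HOL-Library.Extended_Nat"
begin

text \<open>
  A finite simple graph is a \<open>pair_graph\<close>: every undirected edge \<open>uv\<close> is represented by the two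
  arcs \<open>(u, v)\<close> and \<open>(v, u)\<close>, so the degree of a vertex is its out-degree.
\<close>

definition regular :: "'a pair_pre_digraph \<Rightarrow> nat \<Rightarrow> bool" where
  "regular G r \<longleftrightarrow> (\<forall>v \<in> pverts G. out_degree (with_proj G) v = r)"

text \<open>
  Colorings are extensional on the vertex set, so that equality of functions is equality of
  colorings of the graph; \<open>\<exists>!\<close> below depends on this.
\<close>

definition proper_coloring :: "'a pair_pre_digraph \<Rightarrow> nat \<Rightarrow> ('a \<Rightarrow> nat) \<Rightarrow> bool" where
  "proper_coloring G k f \<longleftrightarrow>
     f \<in> pverts G \<rightarrow>\<^sub>E {..<k} \<and> (\<forall>(u, v) \<in> parcs G. f u \<noteq> f v)"

definition chromatic_number :: "'a pair_pre_digraph \<Rightarrow> nat" where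
  "chromatic_number G = (LEAST k. \<exists>f. proper_coloring G k f)"

definition defining_set :: "'a pair_pre_digraph \<Rightarrow> 'a set \<Rightarrow> ('a \<Rightarrow> nat) \<Rightarrow> bool" where
  "defining_set G S c \<longleftrightarrow>
     S \<subseteq> pverts G \<and> c \<in> S \<rightarrow> {..<chromatic_number G} \<and>
     (\<exists>!f. proper_coloring G (chromatic_number G) f \<and> (\<forall>v \<in> S. f v = c v))"

definition defining_number :: "'a pair_pre_digraph \<Rightarrow> nat" where
  "defining_number G = (LEAST m. \<exists>S c. defining_set G S c \<and> card S = m)"

text \<open>
  Up to isomorphism every finite graph has its vertices in \<open>nat\<close>. The minimum is taken in \<open>enat\<close>,
  where it is \<open>\<infinity>\<close> if there is no such graph; a finite value is therefore attained.
\<close>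

definition min_defining_number :: "nat \<Rightarrow> nat \<Rightarrow> nat \<Rightarrow> enat" where
  "min_defining_number n r k =
     (INF G \<in> {G :: nat pair_pre_digraph.
                 pair_graph G \<and> card (pverts G) = n \<and> regular G r \<and> chromatic_number G = k}.
        enat (defining_number G))"

lemma chromatic_number_attained:
  assumes "pair_graph G"
  shows "\<exists>f. proper_coloring G (chromatic_number G) f"
proof -
  interpret pair_graph G by fact
  obtain h :: "'a \<Rightarrow> nat" where h: "bij_betw h (pverts G) {..<card (pverts G)}"
    using ex_bij_betw_finite_nat[OF pair_finite_verts] by (auto simp: atLeast0LessThan)
  have "proper_coloring G (card (pverts G)) (restrict h (pverts G))"
    unfolding proper_coloring_def
  proof (intro conjI ballI)
    show "restrict h (pverts G) \<in> pverts G \<rightarrow>\<^sub>E {..<card (pverts G)}"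
      using h by (auto dest: bij_betwE)
  next
    fix e assume e: "e \<in> parcs G"
    note arc_fst_in_verts[OF e] arc_snd_in_verts[OF e] pair_no_loops[OF e]
    then show "case e of (u, v) \<Rightarrow> restrict h (pverts G) u \<noteq> restrict h (pverts G) v"
      using bij_betw_imp_inj_on[OF h] by (simp add: case_prod_beta inj_on_eq_iff)
  qed
  then have "\<exists>k f. proper_coloring G k f" by blast
  then show ?thesis
    unfolding chromatic_number_def by (rule LeastI_ex)
qed

lemma defining_number_attained:
  assumes "pair_graph G"
  shows "\<exists>S c. defining_set G S c \<and> card S = defining_number G"
proof -
  obtain f where f: "proper_coloring G (chromatic_number G) f"
    using chromatic_number_attained[OF assms] by blast
  have "g = f" if "proper_coloring G (chromatic_number G) g" "\<forall>v \<in> pverts G. g v = f v" for g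
    using that f unfolding proper_coloring_def by (metis PiE_ext)
  then have "defining_set G (pverts G) f"
    unfolding defining_set_def using f by (intro conjI ex1I[of _ f]) (auto simp: proper_coloring_def)
  then have "\<exists>m S c. defining_set G S c \<and> card S = m" by blast
  then show ?thesis
    unfolding defining_number_def by (rule LeastI_ex)
qed

end

theory Submission
  imports Defs
begin

text \<open>
  Lower bound: a defining set with fewer than \<open>k - 1\<close> vertices leaves two colors unused, and these
  can be swapped in every extension.

  Upper bound: write \<open>n = 2 * k + m\<close> with \<open>m \<le> k - 2\<close> and join each of the vertices \<open>0, \<dots>, n - 1\<close> to the
  \<open>k - 1\<close> cyclically nearest vertices on either side. Every vertex \<open>v \<ge> k - 1\<close> sees its \<open>k - 1\<close>
  predecessors, so the colors of the first \<open>k - 1\<close> vertices force the color \<open>v mod k\<close> everywhere.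
  This coloring fails exactly on the wrap-around edges \<open>{x, x + 2 * k}\<close> with \<open>x < m\<close>. A
  degree-preserving switch along one closed alternating trail removes these edges, and every vertex
  \<open>v \<ge> k\<close> still sees all colors but its own among the smaller vertices.
\<close>

section \<open>Lower bound for an arbitrary graph\<close>

lemma no_proper_coloring_below_chromatic_number:
  assumes "proper_coloring G j f" "j < chromatic_number G"
  shows False
  using assms not_less_Least[of j "\<lambda>k. \<exists>f. proper_coloring G k f"]
  by (auto simp: chromatic_number_def)

lemma proper_coloring_recolor:
  assumes "pair_graph G" "proper_coloring G j f"
    and "inj_on p (f ` pverts G)" "p ` f ` pverts G \<subseteq> {..<l}"
  shows "proper_coloring G l (restrict (p \<circ> f) (pverts G))"
proof -
  interpret pair_graph G by fact
  have "restrict (p \<circ> f) (pverts G) u \<noteq> restrict (p \<circ> f) (pverts G) v"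
    if "(u, v) \<in> parcs G" for u v
  proof -
    have uv: "u \<in> pverts G" "v \<in> pverts G" "f u \<noteq> f v"
      using that in_arcsD1 in_arcsD2 assms(2) unfolding proper_coloring_def by auto
    then have "p (f u) \<noteq> p (f v)" using inj_onD[OF assms(3)] by blast
    then show ?thesis using uv by simp
  qed
  moreover have "p (f v) < l" if "v \<in> pverts G" for v using assms(4) that by blast
  ultimately show ?thesis
    unfolding proper_coloring_def by (intro conjI) (simp, blast)
qed

lemma defining_number_ge:
  assumes "pair_graph G"
  shows "chromatic_number G - 1 \<le> defining_number G"
proof (rule ccontr)
  let ?K = "chromatic_number G"
  assume neg: "\<not> ?K - 1 \<le> defining_number G"
  obtain S c where S: "defining_set G S c" and card_S: "card S = defining_number G"
    using defining_number_attained[OF assms] by blast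
  obtain f where f: "proper_coloring G ?K f" "\<forall>v \<in> S. f v = c v"
    and uniq: "\<And>g. proper_coloring G ?K g \<Longrightarrow> \<forall>v \<in> S. g v = c v \<Longrightarrow> g = f"
    using S unfolding defining_set_def by blast
  have sub: "S \<subseteq> pverts G" using S unfolding defining_set_def by blast
  interpret pair_graph G by fact
  have "finite S" using sub pair_finite_verts by (rule finite_subset)
  then have "card (c ` S) \<le> card S" by (rule card_image_le)
  moreover have "card {..<?K} - card (c ` S) \<le> card ({..<?K} - c ` S)"
    using \<open>finite S\<close> by (intro diff_card_le_card_Diff) simp
  ultimately have "2 \<le> card ({..<?K} - c ` S)" using neg card_S by simp
  then obtain T where "T \<subseteq> {..<?K} - c ` S" "card T = 2"
    by (meson obtain_subset_with_card_n)
  then obtain a b where ab: "a \<noteq> b" "a < ?K" "b < ?K" "a \<notin> c ` S" "b \<notin> c ` S"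
    by (auto simp: card_2_iff)
  have f_K: "f v < ?K" if "v \<in> pverts G" for v
    using f(1) that unfolding proper_coloring_def by auto
  define g where "g = restrict (Transposition.transpose a b \<circ> f) (pverts G)"
  have "proper_coloring G ?K g"
    unfolding g_def using f_K ab(2,3)
    by (intro proper_coloring_recolor[OF assms f(1)])
      (auto simp: Transposition.transpose_def intro: inj_on_subset[OF inj_transpose])
  moreover have "\<forall>v \<in> S. g v = c v"
    using f(2) ab(4,5) sub unfolding g_def by (auto simp: Transposition.transpose_def)
  ultimately have "g = f" by (rule uniq)
  \<comment> \<open>By uniqueness the swap leaves \<open>f\<close> unchanged, so \<open>f\<close>
    avoids \<open>a\<close>.\<close>
  then have f_a: "f v \<noteq> a" if "v \<in> pverts G" for v
    using that ab(1) unfolding g_def by (metis comp_apply restrict_apply' transpose_apply_first)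
  \<comment> \<open>Moving the top color to the free color \<open>a\<close> saves one color, which
    contradicts the minimality of the chromatic number.\<close>
  define p where "p = (\<lambda>x. if x = ?K - 1 then a else x)"
  have "p x < ?K - 1" if "x \<in> f ` pverts G" for x
    using that f_a f_K ab(2) unfolding p_def by fastforce
  moreover have "inj_on p (f ` pverts G)"
    using f_a unfolding p_def inj_on_def by auto
  ultimately have "proper_coloring G (?K - 1) (restrict (p \<circ> f) (pverts G))"
    by (intro proper_coloring_recolor[OF assms f(1)]) auto
  then show False by (rule no_proper_coloring_below_chromatic_number) (use ab(2) in simp)
qed

section \<open>The switched circulant and its degrees\<close>

text \<open>Edges are listed upwards and symmetrized by \<open>symclp\<close>. The second
  alternative is the wrap-around, \<open>2 * k + m - (y - x) < k\<close>.\<close>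

definition circulant :: "nat \<Rightarrow> nat \<Rightarrow> nat \<Rightarrow> nat \<Rightarrow> bool" where
  "circulant k m x y \<longleftrightarrow> x < y \<and> y < 2 * k + m \<and> (y < x + k \<or> x + k + m < y)"

text \<open>
  For \<open>x < m - 1\<close> the trail runs from \<open>x + 2 * k\<close> through \<open>x\<close>, \<open>x + k + 1\<close> and \<open>x + k\<close> to \<open>(x + 1) + 2 * k\<close>,
  alternately along removed and added edges; from \<open>(m - 1) + 2 * k\<close> it returns to \<open>2 * k\<close> through
  \<open>m - 1\<close>, \<open>m + k\<close>, \<open>m + k + 1\<close>, \<open>m\<close> and \<open>k - 1\<close>.
\<close>

definition removed :: "nat \<Rightarrow> nat \<Rightarrow> nat \<Rightarrow> nat \<Rightarrow> bool" where
  "removed k m x y \<longleftrightarrow> 0 < m \<and>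
     (x < m \<and> y = x + 2 * k
      \<or> (k \<le> x \<and> x + 1 < k + m \<or> x = k + m) \<and> y = x + 1
      \<or> x = m \<and> y = k - 1)"

definition added :: "nat \<Rightarrow> nat \<Rightarrow> nat \<Rightarrow> nat \<Rightarrow> bool" where
  "added k m x y \<longleftrightarrow> 0 < m \<and> (x \<le> m \<or> k \<le> x + 1 \<and> x + 1 < k + m) \<and> y = x + k + 1"

definition switched_edge :: "nat \<Rightarrow> nat \<Rightarrow> nat \<Rightarrow> nat \<Rightarrow> bool" where
  "switched_edge k m x y \<longleftrightarrow> circulant k m x y \<and> \<not> removed k m x y \<or> added k m x y"

definition switched_circulant :: "nat \<Rightarrow> nat \<Rightarrow> nat pair_pre_digraph" where
  "switched_circulant k m =
     \<lparr>pverts = {..<2 * k + m}, parcs = {(x, y). symclp (switched_edge k m) x y}\<rparr>"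

lemma card_circulant:
  assumes "v < 2 * k + m" "1 \<le> k"
  shows "card {y. symclp (circulant k m) v y} = 2 * (k - 1)"
proof -
  consider "v < k" | "k \<le> v" "v < k + m" | "k + m \<le> v" by linarith
  then show ?thesis
  proof cases
    case 1
    then have "{y. symclp (circulant k m) v y} = ({..<v + k} - {v}) \<union> {v + k + m<..<2 * k + m}"
      by (auto simp: symclp_def circulant_def)
    moreover have "card (({..<v + k} - {v}) \<union> {v + k + m<..<2 * k + m}) = (v + k - 1) + (k - 1 - v)"
      using 1 by (subst card_Un_disjoint) (auto simp: card_Diff_subset)
    ultimately show ?thesis using 1 by simp
  next
    case 2
    then have "{y. symclp (circulant k m) v y} = {v - k<..<v + k} - {v}"
      using assms by (auto simp: symclp_def circulant_def)
    moreover have "card ({v - k<..<v + k} - {v}) = 2 * (k - 1)"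
      using 2 assms by (subst card_Diff_subset) auto
    ultimately show ?thesis by simp
  next
    case 3
    then have "{y. symclp (circulant k m) v y} = ({v - k<..<2 * k + m} - {v}) \<union> {..<v - k - m}"
      using assms by (auto simp: symclp_def circulant_def)
    moreover have "card (({v - k<..<2 * k + m} - {v}) \<union> {..<v - k - m})
        = (2 * k + m - Suc (v - k) - 1) + (v - k - m)"
      using 3 assms by (subst card_Un_disjoint) (auto simp: card_Diff_subset)
    ultimately show ?thesis using 3 assms by simp
  qed
qed

text \<open>Each visit of the closed alternating trail to a vertex uses one removed and one added
  edge.\<close>

lemma card_removed_eq_card_added:
  assumes "m + 2 \<le> k" "v < 2 * k + m"
  shows "card {y. symclp (removed k m) v y} = card {y. symclp (added k m) v y}"
proof (cases "m = 0")
  case True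
  then show ?thesis by (simp add: symclp_def removed_def added_def)
next
  case False
  have D: "{y. symclp (removed k m) v y} =
      (if v < m then {v + 2 * k} else {}) \<union>
      (if k \<le> v \<and> v + 1 < k + m \<or> v = k + m then {v + 1} else {}) \<union>
      (if v = m then {k - 1} else {}) \<union>
      (if 2 * k \<le> v then {v - 2 * k} else {}) \<union>
      (if k < v \<and> v < k + m \<or> v = k + m + 1 then {v - 1} else {}) \<union>
      (if v + 1 = k then {m} else {})"
    using assms False unfolding symclp_def removed_def by (auto split: if_splits)
  have A: "{y. symclp (added k m) v y} =
      (if v \<le> m \<or> k \<le> v + 1 \<and> v + 1 < k + m then {v + k + 1} else {}) \<union>
      (if k < v \<and> v \<le> k + m + 1 \<or> 2 * k \<le> v then {v - k - 1} else {})"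
    using assms False unfolding symclp_def added_def by (auto split: if_splits)
  consider "v < k" | "k \<le> v" "v < 2 * k" | "2 * k \<le> v" by linarith
  then show ?thesis
  proof cases
    case 1
    then consider "v < m" | "v = m" | "m < v" "v + 1 < k" | "m < v" "v + 1 = k" by linarith
    then show ?thesis unfolding D A using 1 assms False by cases simp_all
  next
    case 2
    then consider "v = k" | "k < v" "v < k + m" | "k + m \<le> v" by linarith
    then show ?thesis
    proof cases
      case 1
      \<comment> \<open>For \<open>m = 1\<close> the trail misses the vertex
        \<open>k\<close>.\<close>
      then show ?thesis unfolding D A using assms False by (cases "m = 1") simp_all
    next
      case v: 2
      then show ?thesis unfolding D A using 2 assms by (cases "v + 1 < k + m") simp_all
    next
      case 3
      then consider "v = k + m" | "v = k + m + 1" | "k + m + 1 < v" by linarith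
      then show ?thesis unfolding D A using 2 assms False by cases simp_all
    qed
  next
    case 3
    then show ?thesis unfolding D A using assms False by simp
  qed
qed

lemma switched_circulant_sel [simp]:
  "pverts (switched_circulant k m) = {..<2 * k + m}"
  "(x, y) \<in> parcs (switched_circulant k m) \<longleftrightarrow> symclp (switched_edge k m) x y"
  by (simp_all add: switched_circulant_def)

lemma switched_edge_less:
  assumes "switched_edge k m x y" "m + 2 \<le> k"
  shows "x < y" "y < 2 * k + m"
  using assms unfolding switched_edge_def circulant_def added_def by auto

lemma pair_graph_switched_circulant:
  assumes "m + 2 \<le> k"
  shows "pair_graph (switched_circulant k m)"
proof -
  let ?G = "switched_circulant k m"
  have inV: "x < 2 * k + m \<and> y < 2 * k + m \<and> x \<noteq> y" if "(x, y) \<in> parcs ?G" for x y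
    using that switched_edge_less[OF _ assms] by (fastforce simp: symclp_def)
  show ?thesis
  proof
    show "finite (parcs ?G)"
      by (rule finite_subset[of _ "{..<2 * k + m} \<times> {..<2 * k + m}"]) (auto dest: inV)
    show "symmetric ?G"
      by (auto simp: symmetric_def sym_def symclp_def)
  qed (use inV in \<open>auto simp: split_paired_all\<close>)
qed

lemma regular_switched_circulant:
  assumes "m + 2 \<le> k"
  shows "regular (switched_circulant k m) (2 * (k - 1))"
  unfolding regular_def
proof
  let ?G = "switched_circulant k m"
  fix v assume "v \<in> pverts ?G"
  then have v: "v < 2 * k + m" by simp
  let ?C = "{y. symclp (circulant k m) v y}" and ?D = "{y. symclp (removed k m) v y}"
    and ?A = "{y. symclp (added k m) v y}"
  \<comment> \<open>An added edge has difference \<open>k + 1\<close>, inside the gap from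
    \<open>k\<close> to \<open>k + m\<close> that the circulant leaves out.\<close>
  have DC: "?D \<subseteq> ?C" and AC: "?A \<inter> ?C = {}"
    using assms unfolding symclp_def circulant_def removed_def added_def by auto
  have fin: "finite ?C" "finite ?A"
    using assms by (auto intro!: finite_subset[of _ "{..<2 * k + m}"] simp: symclp_def circulant_def added_def)
  \<comment> \<open>As all three relations point upwards, the symmetric closure commutes with the
    set difference.\<close>
  have order: "x < y" if "circulant k m x y \<or> removed k m x y \<or> added k m x y" for x y
    using that assms unfolding circulant_def removed_def added_def by auto
  have "{y. symclp (switched_edge k m) v y} = (?C - ?D) \<union> ?A"
    unfolding symclp_def switched_edge_def using order by (blast dest: less_asym)
  then have "card {y. symclp (switched_edge k m) v y} = card (?C - ?D) + card ?A"
    using AC fin by (simp only:) (intro card_Un_disjoint; blast)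
  also have "card (?C - ?D) = card ?C - card ?D"
    using DC fin by (simp add: card_Diff_subset finite_subset)
  also have "card ?C - card ?D + card ?A = card ?C"
    using card_mono[OF fin(1) DC] card_removed_eq_card_added[OF assms v] by simp
  also have "\<dots> = 2 * (k - 1)" using card_circulant[OF v] assms by simp
  finally have "card {y. symclp (switched_edge k m) v y} = 2 * (k - 1)" .
  moreover have "out_arcs (with_proj ?G) v = Pair v ` {y. symclp (switched_edge k m) v y}"
    by (auto simp: out_arcs_def)
  ultimately show "out_degree (with_proj ?G) v = 2 * (k - 1)"
    by (simp add: out_degree_def card_image inj_on_def)
qed

section \<open>Colorings of the switched circulant\<close>

text \<open>Equal residues mean difference \<open>k\<close> or \<open>2 * k\<close>. The circulant
  has no edge of the first kind, all edges of the second kind are removed, and added edges have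
  difference \<open>k + 1\<close>.\<close>

lemma switched_edge_mod_neq:
  assumes "switched_edge k m x y" "m + 2 \<le> k"
  shows "x mod k \<noteq> y mod k"
proof
  assume eq: "x mod k = y mod k"
  note xy = switched_edge_less[OF assms]
  then obtain q where q: "y = x + k * q"
    using eq by (metis mod_eq_nat1E less_imp_le)
  have "q \<noteq> 0" using q xy by auto
  moreover have "q < 3"
  proof (rule ccontr)
    assume "\<not> q < 3"
    then have "k * 3 \<le> k * q" by simp
    then show False using q xy assms by linarith
  qed
  ultimately have "q = 1 \<or> q = 2" by auto
  then show False
    using assms q xy unfolding switched_edge_def circulant_def added_def removed_def by auto
qed

lemma proper_coloring_mod:
  assumes "m + 2 \<le> k"
  shows "proper_coloring (switched_circulant k m) k (restrict (\<lambda>v. v mod k) {..<2 * k + m})"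
proof -
  have "x < 2 * k + m \<and> y < 2 * k + m \<and> x mod k \<noteq> y mod k" if "symclp (switched_edge k m) x y" for x y
    using that
  proof cases
    case base
    then show ?thesis using switched_edge_less[OF base assms] switched_edge_mod_neq[OF base assms] by simp
  next
    case sym
    then show ?thesis using switched_edge_less[OF sym assms] switched_edge_mod_neq[OF sym assms] by simp
  qed
  then show ?thesis using assms unfolding proper_coloring_def by auto
qed

context
  fixes k m :: nat and f :: "nat \<Rightarrow> nat"
  assumes km: "m + 2 \<le> k"
    and f_edge: "\<And>x y. switched_edge k m x y \<Longrightarrow> f x \<noteq> f y"
begin

text \<open>The rows are \<open>i\<close> and \<open>k + i\<close> with \<open>i < k\<close>, then
  \<open>2 * k + j\<close> with \<open>j < m\<close>. Within the first row the switch deletes only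
  the edge between \<open>m\<close> and \<open>k - 1\<close>.\<close>

lemma first_row_neq:
  assumes "i < j" "j < k" "m = 0 \<or> (i, j) \<noteq> (m, k - 1)"
  shows "f i \<noteq> f j"
  by (rule f_edge) (use assms km in \<open>auto simp: switched_edge_def circulant_def removed_def\<close>)

lemma second_row_neq_later:
  assumes "j < i" "i < k"
  shows "f i \<noteq> f (k + j)"
  by (rule f_edge) (use assms km in \<open>auto simp: switched_edge_def circulant_def removed_def\<close>)

text \<open>If the edge between \<open>k + i\<close> and \<open>k + j\<close> was removed, then
  \<open>j = i + 1\<close> and the added edge from \<open>i\<close> to \<open>k + j\<close> replaces
  it, with the same color at \<open>i\<close>.\<close>

lemma second_row_neq_earlier:
  assumes "i < j" "j < k" "f (k + i) = f i"
  shows "f i \<noteq> f (k + j)"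
proof (cases "removed k m (k + i) (k + j)")
  case True
  then have "added k m i (k + j)" using assms km unfolding removed_def added_def by auto
  then show ?thesis using f_edge[of i "k + j"] by (simp add: switched_edge_def)
next
  case False
  then have "switched_edge k m (k + i) (k + j)"
    using assms by (auto simp: switched_edge_def circulant_def)
  then show ?thesis using f_edge assms(3) by metis
qed

text \<open>The only consecutive pair here, \<open>2 * k - 1\<close> and \<open>2 * k\<close>,
  survives the switch because \<open>k + m < 2 * k - 1\<close>.\<close>

lemma third_row_neq_later:
  assumes "j < i" "i < k" "j < m"
  shows "f (k + i) \<noteq> f (2 * k + j)"
  by (rule f_edge) (use assms km in \<open>auto simp: switched_edge_def circulant_def removed_def\<close>)

lemma third_row_neq_earlier:
  assumes "i < j" "j < m"
  shows "f (2 * k + i) \<noteq> f (2 * k + j)"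
  by (rule f_edge) (use assms km in \<open>auto simp: switched_edge_def circulant_def removed_def\<close>)

text \<open>With \<open>k - 1\<close> colors the vertex \<open>k - 1\<close> repeats the color of some \<open>c < k - 1\<close>. Then the colors
  of \<open>k, \<dots>, k + c - 1\<close> are forced one after the other and no color is left for \<open>k + c\<close>.\<close>

lemma not_fewer_colors:
  assumes "\<And>v. v < 2 * k + m \<Longrightarrow> f v < k - 1"
  shows False
proof -
  have "inj_on f {..<k - 1}"
    using first_row_neq by (intro linorder_inj_onI) auto
  then have surj: "f ` {..<k - 1} = {..<k - 1}"
    using assms by (intro card_subset_eq) (auto simp: card_image)
  have hit: "\<exists>i<k - 1. f v = f i" if "v < 2 * k + m" for v
    using assms[OF that] surj by (metis imageE lessThan_iff)
  have last: "k - 1 < 2 * k + m" using km by linarith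
  obtain c where c: "c < k - 1" "f (k - 1) = f c" using hit[OF last] by blast
  have "f (k + j) = f j" if "j \<le> c" for j
    using that
  proof (induction j rule: less_induct)
    case (less j)
    then obtain i where i: "i < k - 1" "f (k + j) = f i" using hit[of "k + j"] c(1) by (auto simp: less_diff_conv)
    then have "\<not> j < i" using second_row_neq_later[of j i] by linarith
    moreover have "\<not> i < j"
      using second_row_neq_earlier[of i j] less.IH[of i] less.prems i(2) c(1) by (auto simp: less_diff_conv)
    ultimately show ?case using i by simp
  qed
  \<comment> \<open>\<open>k + c\<close> has the color of \<open>c\<close>, hence that of its
    neighbor \<open>k - 1\<close>.\<close>
  then show False using c second_row_neq_later[of c "k - 1"] by simp
qed

text \<open>Vertex \<open>0\<close> gets the one color left. Then each row is filled from left to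
  right: at position \<open>j\<close> the row above excludes the larger colors, and the earlier
  positions exclude the smaller ones.\<close>

lemma coloring_forced:
  assumes lt: "\<And>v. v < 2 * k + m \<Longrightarrow> f v < k"
    and S: "\<And>v. v \<in> {1..<k} \<Longrightarrow> f v = v"
    and v: "v < 2 * k + m"
  shows "f v = v mod k"
proof -
  have "f 0 \<noteq> i" if "i \<in> {1..<k}" for i
    using first_row_neq[of 0 i] S[OF that] that by (cases "m = 0") auto
  then have "\<not> (1 \<le> f 0 \<and> f 0 < k)" by auto
  then have "f 0 = 0" using lt[of 0] km by linarith
  then have s: "f i = i" if "i < k" for i using S[of i] that by (cases i) auto
  have t: "f (k + j) = j" if "j < k" for j
    using that
  proof (induction j rule: less_induct)
    case (less j)
    have "\<not> j < f (k + j)"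
      using second_row_neq_later[of j "f (k + j)"] s lt[of "k + j"] less.prems by auto
    moreover have "\<not> f (k + j) < j"
      using second_row_neq_earlier[of "f (k + j)" j] s less by auto
    ultimately show ?case by simp
  qed
  have u: "f (2 * k + j) = j" if "j < m" for j
    using that
  proof (induction j rule: less_induct)
    case (less j)
    have "\<not> j < f (2 * k + j)"
      using third_row_neq_later[of j "f (2 * k + j)"] t lt[of "2 * k + j"] less.prems by auto
    moreover have "\<not> f (2 * k + j) < j"
      using third_row_neq_earlier[of "f (2 * k + j)" j] less by auto
    ultimately show ?case by simp
  qed
  consider "v < k" | j where "v = k + j" "j < k" | j where "v = 2 * k + j" "j < m"
    using v by (metis add_less_cancel_left le_Suc_ex mult_2 not_less add.assoc)
  then show ?thesis using s t u km by cases auto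
qed

end

lemma chromatic_number_switched_circulant:
  assumes "m + 2 \<le> k"
  shows "chromatic_number (switched_circulant k m) = k"
proof -
  let ?G = "switched_circulant k m"
  have "chromatic_number ?G \<le> k"
    unfolding chromatic_number_def using proper_coloring_mod[OF assms] by (intro Least_le) blast
  moreover have "k \<le> chromatic_number ?G"
  proof (rule ccontr)
    assume neg: "\<not> k \<le> chromatic_number ?G"
    obtain f where f: "proper_coloring ?G (chromatic_number ?G) f"
      using chromatic_number_attained[OF pair_graph_switched_circulant[OF assms]] by blast
    have "f v < k - 1" if "v < 2 * k + m" for v
    proof -
      have "f v < chromatic_number ?G"
        using f that unfolding proper_coloring_def by auto
      then show ?thesis using neg by simp
    qed
    moreover have "f x \<noteq> f y" if "switched_edge k m x y" for x y
      using f that unfolding proper_coloring_def by fastforce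
    ultimately show False using not_fewer_colors[OF assms] by blast
  qed
  ultimately show ?thesis by simp
qed

text \<open>The set omits \<open>0\<close> rather than \<open>k - 1\<close>: for
  \<open>0 < m\<close> the vertex \<open>k - 1\<close> has lost its edge to \<open>m\<close>, while
  \<open>0\<close> keeps all its neighbors in the first row.\<close>

lemma defining_set_switched_circulant:
  assumes "m + 2 \<le> k"
  shows "defining_set (switched_circulant k m) {1..<k} (\<lambda>v. v)"
  unfolding defining_set_def chromatic_number_switched_circulant[OF assms]
proof (intro conjI ex1I)
  let ?G = "switched_circulant k m" and ?c = "restrict (\<lambda>v. v mod k) {..<2 * k + m}"
  show "{1..<k} \<subseteq> pverts ?G" and "(\<lambda>v. v) \<in> {1..<k} \<rightarrow> {..<k}" by auto
  show "proper_coloring ?G k ?c" by (rule proper_coloring_mod[OF assms])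
  show "\<forall>v \<in> {1..<k}. ?c v = v" by simp
  fix f assume f: "proper_coloring ?G k f \<and> (\<forall>v \<in> {1..<k}. f v = v)"
  have "f x \<noteq> f y" if "switched_edge k m x y" for x y
    using f that unfolding proper_coloring_def by fastforce
  moreover have "f v < k" if "v < 2 * k + m" for v
    using f that unfolding proper_coloring_def by auto
  ultimately have "f v = v mod k" if "v < 2 * k + m" for v
    using coloring_forced[OF assms] f that by blast
  \<comment> \<open>Equality of extensional functions also concerns arguments off the vertex
    set.\<close>
  moreover have "f v = undefined" if "\<not> v < 2 * k + m" for v
    using f that unfolding proper_coloring_def by auto
  ultimately show "f = ?c" by (auto simp: restrict_def)
qed

theorem theorem3p3:
  fixes k n :: nat
  assumes "even k" and "4 \<le> k" and "2 * k \<le> n" and "n \<le> 3 * k - 2"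
  shows "min_defining_number n (2 * (k - 1)) k = enat (k - 1)"
proof -
  define m where "m = n - 2 * k"
  have km: "m + 2 \<le> k" and n: "n = 2 * k + m" using assms(2-4) unfolding m_def by auto
  let ?G = "switched_circulant k m"
  show ?thesis
    unfolding min_defining_number_def
  proof (intro antisym INF_greatest)
    have "defining_number ?G \<le> k - 1"
      unfolding defining_number_def
      using defining_set_switched_circulant[OF km] by (intro Least_le) force
    then show "(INF G \<in> {G :: nat pair_pre_digraph. pair_graph G \<and> card (pverts G) = n \<and>
        regular G (2 * (k - 1)) \<and> chromatic_number G = k}. enat (defining_number G)) \<le> enat (k - 1)"
      using km n
        pair_graph_switched_circulant[OF km] regular_switched_circulant[OF km]
        chromatic_number_switched_circulant[OF km]
      by (intro INF_lower2[of ?G]) auto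
  next
    fix G :: "nat pair_pre_digraph"
    assume "G \<in> {G. pair_graph G \<and> card (pverts G) = n \<and>
        regular G (2 * (k - 1)) \<and> chromatic_number G = k}"
    then show "enat (k - 1) \<le> enat (defining_number G)"
      using defining_number_ge[of G] by simp
  qed
qed

end
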